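(* Let $0\to\mathfrak{h}_S\xrightarrow{i}\mathfrak{e}_U\xrightarrow{p}\mathfrak{g}_T\to0$ be an abelian extension of the Rota-Baxter Lie algebra $\mathfrak{g}_T$ by a representation $\mathfrak{h}_S$ with action map $\psi$, and let $(\chi,\Phi)$ be the $2$-cocycle associated to the extension and a section $s$ of $p$. A pair $(\beta,\alpha)\in\mathrm{Aut}(\mathfrak{h}_S)\times\mathrm{Aut}(\mathfrak{g}_T)$ is inducible if and only if (1) $(\beta,\alpha)\in C_\psi$, and (2) the $2$-cocycles $(\chi_{(\beta,\alpha)},\Phi_{(\beta,\alpha)})$ and $(\chi,\Phi)$ are cohomologous.
   Context: All vector spaces, linear maps and Lie algebras are over a field $\mathbf{k}$ of characteristic $0$. A Rota-Baxter Lie algebra $\mathfrak{g}_T$ is a Lie algebra $\mathfrak{g}$ with a linear map $T:\mathfrak{g}\to\mathfrak{g}$ satisfying $[T(x),T(y)]_\mathfrak{g}=T([T(x),y]_\mathfrak{g}+[x,T(y)]_\mathfrak{g})$ for all $x,y\in\mathfrak{g}$. A morphism $\mathfrak{g}_T\to\mathfrak{g}'_{T'}$ is a Lie algebra homomorphism $\varphi$ with $T'\circ\varphi=\varphi\circ T$; $\mathrm{Aut}(\mathfrak{g}_T)$ is the group of bijective morphisms $\mathfrak{g}_T\to\mathfrak{g}_T$. A representation $\mathfrak{h}_S$ of $\mathfrak{g}_T$ is a vector space $\mathfrak{h}$ with a Lie algebra homomorphism $\psi:\mathfrak{g}\to\mathrm{End}(\mathfrak{h})$ and a linear map $S:\mathfrak{h}\to\mathfrak{h}$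 such that $\psi_{T(x)}S(h)=S(\psi_{T(x)}h+\psi_xS(h))$ for all $x\in\mathfrak{g}$, $h\in\mathfrak{h}$. Such $\mathfrak{h}_S$ is viewed as a Rota-Baxter Lie algebra with zero bracket (so $\mathrm{Aut}(\mathfrak{h}_S)$ consists of linear bijections commuting with $S$). An abelian extension of $\mathfrak{g}_T$ by the representation $\mathfrak{h}_S$ is a Rota-Baxter Lie algebra $\mathfrak{e}_U$ with a short exact sequence $0\to\mathfrak{h}_S\xrightarrow{i}\mathfrak{e}_U\xrightarrow{p}\mathfrak{g}_T\to0$ of morphisms of Rota-Baxter Lie algebras ($\mathfrak{h}$ with zero bracket, identified with $i(\mathfrak{h})$) such that $\psi_xh=[s(x),h]_\mathfrak{e}$ for any section $s$ of $p$, i.e. linear $s:\mathfrak{g}\to\mathfrak{e}$ with $p\circ s=\mathrm{id}_\mathfrak{g}$ (this is independent of $s$). A $2$-cocycle of $\mathfrak{g}_T$ with coefficients in $\mathfrak{h}_S$ is a pair $(\chi,\Phi)$ of linear maps $\chi:\wedge^2\mathfrak{g}\to\mathfrak{h}$, $\Phi:\mathfrak{g}\to\mathfrak{h}$ such that $\chi$ is a Chevalley-Eilenberg $2$-cocycle of $\mathfrak{g}$ with coefficients in $(\mathfrak{h},\psi)$ and, for all $x,y\in\mathfrak{g}$, $\psi_{T(x)}\Phi(y)-\psi_{T(y)}\Phi(x)-S(\psi_x\Phi(y)-\psi_y\Phi(x))-\Phi([T(x),y]_\mathfrak{g}+[x,T(y)]_\mathfrak{g})+\chi(T(x),T(y))-S(\chi(T(x),y)+\chi(x,T(y)))=0$.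 Two $2$-cocycles $(\chi,\Phi)$, $(\chi',\Phi')$ are cohomologous if there is a linear map $f:\mathfrak{g}\to\mathfrak{h}$ with $\chi(x,y)-\chi'(x,y)=\psi_xf(y)-\psi_yf(x)-f([x,y]_\mathfrak{g})$ and $\Phi(x)-\Phi'(x)=S(f(x))-f(T(x))$ for all $x,y\in\mathfrak{g}$. The $2$-cocycle associated to $s$ is $\chi(x,y)=[s(x),s(y)]_\mathfrak{e}-s[x,y]_\mathfrak{g}$, $\Phi(x)=U(s(x))-s(T(x))$. For $(\beta,\alpha)\in\mathrm{Aut}(\mathfrak{h}_S)\times\mathrm{Aut}(\mathfrak{g}_T)$: $\chi_{(\beta,\alpha)}(x,y)=\beta\chi(\alpha^{-1}(x),\alpha^{-1}(y))$ and $\Phi_{(\beta,\alpha)}(x)=\beta\Phi(\alpha^{-1}(x))$. The subgroup of compatible pairs is $C_\psi=\{(\beta,\alpha)\in\mathrm{Aut}(\mathfrak{h}_S)\times\mathrm{Aut}(\mathfrak{g}_T)\mid\beta(\psi_xh)=\psi_{\alpha(x)}\beta(h)\ \forall x\in\mathfrak{g},h\in\mathfrak{h}\}$; when $(\beta,\alpha)\in C_\psi$, $(\chi_{(\beta,\alpha)},\Phi_{(\beta,\alpha)})$ is a $2$-cocycle. A pair $(\beta,\alpha)\in\mathrm{Aut}(\mathfrak{h}_S)\times\mathrm{Aut}(\mathfrak{g}_T)$ is inducible if there is $\gamma\in\mathrm{Aut}(\mathfrak{e}_U)$ with $\gamma(\mathfrak{h})\subset\mathfrak{h}$, $\gamma|_\mathfrak{h}=\beta$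 and $p\gamma s=\alpha$ (the map $p\gamma s$ does not depend on $s$). *)

theory Defs
  imports Complex_Main
begin

text \<open>
  A vector space over a field of characteristic \<open>0\<close> is a type of class \<^class>\<open>ab_group_add\<close> with a
  scalar multiplication satisfying \<^locale>\<open>vector_space\<close>; the structure maps are passed explicitly.
\<close>

section \<open>Rota-Baxter Lie algebras, morphisms and representations\<close>

locale lie_algebra = vector_space scale
  for scale :: "'k::field_char_0 \<Rightarrow> 'g::ab_group_add \<Rightarrow> 'g" +
  fixes br :: "'g \<Rightarrow> 'g \<Rightarrow> 'g"
  assumes br_linear_left: "\<And>y. Vector_Spaces.linear scale scale (\<lambda>x. br x y)"
    and br_linear_right: "\<And>x. Vector_Spaces.linear scale scale (\<lambda>y. br x y)"
    and br_alternating: "\<And>x. br x x = 0"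
    and jacobi: "\<And>x y z. br x (br y z) + br y (br z x) + br z (br x y) = 0"

locale rota_baxter_lie_algebra = lie_algebra scale br
  for scale :: "'k::field_char_0 \<Rightarrow> 'g::ab_group_add \<Rightarrow> 'g"
    and br :: "'g \<Rightarrow> 'g \<Rightarrow> 'g" +
  fixes T :: "'g \<Rightarrow> 'g"
  assumes T_linear: "Vector_Spaces.linear scale scale T"
    and rota_baxter: "\<And>x y. br (T x) (T y) = T (br (T x) y + br x (T y))"

locale rota_baxter_hom =
  dom: rota_baxter_lie_algebra scale1 br1 T1 +
  cod: rota_baxter_lie_algebra scale2 br2 T2 +
  Vector_Spaces.linear scale1 scale2 \<phi>
  for scale1 :: "'k::field_char_0 \<Rightarrow> 'a::ab_group_add \<Rightarrow> 'a"
    and br1 :: "'a \<Rightarrow> 'a \<Rightarrow> 'a" and T1 :: "'a \<Rightarrow> 'a"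
    and scale2 :: "'k \<Rightarrow> 'b::ab_group_add \<Rightarrow> 'b"
    and br2 :: "'b \<Rightarrow> 'b \<Rightarrow> 'b" and T2 :: "'b \<Rightarrow> 'b"
    and \<phi> :: "'a \<Rightarrow> 'b" +
  assumes hom_br: "\<And>x y. \<phi> (br1 x y) = br2 (\<phi> x) (\<phi> y)"
    and hom_T: "\<And>x. T2 (\<phi> x) = \<phi> (T1 x)"

definition rota_baxter_aut ::
  "('k::field_char_0 \<Rightarrow> 'a::ab_group_add \<Rightarrow> 'a) \<Rightarrow> ('a \<Rightarrow> 'a \<Rightarrow> 'a) \<Rightarrow> ('a \<Rightarrow> 'a) \<Rightarrow> ('a \<Rightarrow> 'a) set"
  where "rota_baxter_aut scale br T = {\<phi>. rota_baxter_hom scale br T scale br T \<phi> \<and> bij \<phi>}"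

text \<open>The bracket of a representation space viewed as a Rota-Baxter Lie algebra.\<close>

abbreviation zero_br :: "'h::zero \<Rightarrow> 'h \<Rightarrow> 'h"
  where "zero_br \<equiv> (\<lambda>_ _. 0)"

text \<open>
  The first three assumptions on \<open>\<psi>\<close> say that \<open>\<psi>\<close> is a Lie algebra homomorphism into the
  endomorphisms of \<open>\<hh>\<close> with the commutator bracket.
\<close>

locale rota_baxter_representation =
  rota_baxter_lie_algebra scaleG brG T + rep: vector_space scaleH
  for scaleG :: "'k::field_char_0 \<Rightarrow> 'g::ab_group_add \<Rightarrow> 'g"
    and brG :: "'g \<Rightarrow> 'g \<Rightarrow> 'g" and T :: "'g \<Rightarrow> 'g"
    and scaleH :: "'k \<Rightarrow> 'h::ab_group_add \<Rightarrow> 'h" +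
  fixes \<psi> :: "'g \<Rightarrow> 'h \<Rightarrow> 'h" and S :: "'h \<Rightarrow> 'h"
  assumes \<psi>_endo: "\<And>x. Vector_Spaces.linear scaleH scaleH (\<psi> x)"
    and \<psi>_linear: "\<And>h. Vector_Spaces.linear scaleG scaleH (\<lambda>x. \<psi> x h)"
    and \<psi>_br: "\<And>x y h. \<psi> (brG x y) h = \<psi> x (\<psi> y h) - \<psi> y (\<psi> x h)"
    and S_linear: "Vector_Spaces.linear scaleH scaleH S"
    and S_rota_baxter: "\<And>x h. \<psi> (T x) (S h) = S (\<psi> (T x) h + \<psi> x (S h))"

section \<open>Abelian extensions\<close>

definition is_section ::
  "('k::field_char_0 \<Rightarrow> 'g::ab_group_add \<Rightarrow> 'g) \<Rightarrow> ('k \<Rightarrow> 'e::ab_group_add \<Rightarrow> 'e)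
    \<Rightarrow> ('e \<Rightarrow> 'g) \<Rightarrow> ('g \<Rightarrow> 'e) \<Rightarrow> bool"
  where "is_section scaleG scaleE p s \<longleftrightarrow> Vector_Spaces.linear scaleG scaleE s \<and> p \<circ> s = id"

text \<open>
  The inclusion \<open>i\<close> is kept explicit: the subspace \<open>\<hh>\<close> of \<open>\<ee>\<close> is \<open>range i\<close>, and an element
  \<open>h\<close> of \<open>\<hh>\<close> is \<open>i h\<close> in \<open>\<ee>\<close>.
\<close>

locale abelian_extension =
  rota_baxter_representation scaleG brG T scaleH \<psi> S +
  incl: rota_baxter_hom scaleH zero_br S scaleE brE U i +
  proj: rota_baxter_hom scaleE brE U scaleG brG T p
  for scaleG :: "'k::field_char_0 \<Rightarrow> 'g::ab_group_add \<Rightarrow> 'g"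
    and brG :: "'g \<Rightarrow> 'g \<Rightarrow> 'g" and T :: "'g \<Rightarrow> 'g"
    and scaleH :: "'k \<Rightarrow> 'h::ab_group_add \<Rightarrow> 'h"
    and \<psi> :: "'g \<Rightarrow> 'h \<Rightarrow> 'h" and S :: "'h \<Rightarrow> 'h"
    and scaleE :: "'k \<Rightarrow> 'e::ab_group_add \<Rightarrow> 'e"
    and brE :: "'e \<Rightarrow> 'e \<Rightarrow> 'e" and U :: "'e \<Rightarrow> 'e"
    and i :: "'h \<Rightarrow> 'e" and p :: "'e \<Rightarrow> 'g" +
  assumes inj_i: "inj i"
    and exact: "range i = {e. p e = 0}"
    and surj_p: "surj p"
    and action: "\<And>s x h. is_section scaleG scaleE p s \<Longrightarrow> i (\<psi> x h) = brE (s x) (i h)"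

section \<open>Cocycles\<close>

text \<open>A linear map on the exterior square is an alternating bilinear map.\<close>

definition is_CE_2_cocycle ::
  "('k::field_char_0 \<Rightarrow> 'g::ab_group_add \<Rightarrow> 'g) \<Rightarrow> ('g \<Rightarrow> 'g \<Rightarrow> 'g)
    \<Rightarrow> ('k \<Rightarrow> 'h::ab_group_add \<Rightarrow> 'h) \<Rightarrow> ('g \<Rightarrow> 'h \<Rightarrow> 'h) \<Rightarrow> ('g \<Rightarrow> 'g \<Rightarrow> 'h) \<Rightarrow> bool"
  where "is_CE_2_cocycle scaleG brG scaleH \<psi> \<chi> \<longleftrightarrow>
    (\<forall>y. Vector_Spaces.linear scaleG scaleH (\<lambda>x. \<chi> x y)) \<and>
    (\<forall>x. Vector_Spaces.linear scaleG scaleH (\<lambda>y. \<chi> x y)) \<and>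
    (\<forall>x. \<chi> x x = 0) \<and>
    (\<forall>x y z. \<psi> x (\<chi> y z) - \<psi> y (\<chi> x z) + \<psi> z (\<chi> x y)
             - \<chi> (brG x y) z + \<chi> (brG x z) y - \<chi> (brG y z) x = 0)"

definition is_2_cocycle ::
  "('k::field_char_0 \<Rightarrow> 'g::ab_group_add \<Rightarrow> 'g) \<Rightarrow> ('g \<Rightarrow> 'g \<Rightarrow> 'g) \<Rightarrow> ('g \<Rightarrow> 'g)
    \<Rightarrow> ('k \<Rightarrow> 'h::ab_group_add \<Rightarrow> 'h) \<Rightarrow> ('g \<Rightarrow> 'h \<Rightarrow> 'h) \<Rightarrow> ('h \<Rightarrow> 'h)
    \<Rightarrow> ('g \<Rightarrow> 'g \<Rightarrow> 'h) \<times> ('g \<Rightarrow> 'h) \<Rightarrow> bool"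
  where "is_2_cocycle scaleG brG T scaleH \<psi> S = (\<lambda>(\<chi>, \<Phi>).
    is_CE_2_cocycle scaleG brG scaleH \<psi> \<chi> \<and>
    Vector_Spaces.linear scaleG scaleH \<Phi> \<and>
    (\<forall>x y. \<psi> (T x) (\<Phi> y) - \<psi> (T y) (\<Phi> x) - S (\<psi> x (\<Phi> y) - \<psi> y (\<Phi> x))
           - \<Phi> (brG (T x) y + brG x (T y))
           + \<chi> (T x) (T y) - S (\<chi> (T x) y + \<chi> x (T y)) = 0))"

definition cohomologous ::
  "('k::field_char_0 \<Rightarrow> 'g::ab_group_add \<Rightarrow> 'g) \<Rightarrow> ('g \<Rightarrow> 'g \<Rightarrow> 'g) \<Rightarrow> ('g \<Rightarrow> 'g)
    \<Rightarrow> ('k \<Rightarrow> 'h::ab_group_add \<Rightarrow> 'h) \<Rightarrow> ('g \<Rightarrow> 'h \<Rightarrow> 'h) \<Rightarrow> ('h \<Rightarrow> 'h)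
    \<Rightarrow> ('g \<Rightarrow> 'g \<Rightarrow> 'h) \<times> ('g \<Rightarrow> 'h) \<Rightarrow> ('g \<Rightarrow> 'g \<Rightarrow> 'h) \<times> ('g \<Rightarrow> 'h) \<Rightarrow> bool"
  where "cohomologous scaleG brG T scaleH \<psi> S = (\<lambda>(\<chi>, \<Phi>) (\<chi>', \<Phi>').
    is_2_cocycle scaleG brG T scaleH \<psi> S (\<chi>, \<Phi>) \<and>
    is_2_cocycle scaleG brG T scaleH \<psi> S (\<chi>', \<Phi>') \<and>
    (\<exists>f. Vector_Spaces.linear scaleG scaleH f \<and>
         (\<forall>x y. \<chi> x y - \<chi>' x y = \<psi> x (f y) - \<psi> y (f x) - f (brG x y)) \<and>
         (\<forall>x. \<Phi> x - \<Phi>' x = S (f x) - f (T x))))"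

text \<open>
  In an abelian extension the arguments of \<open>inv i\<close> below lie in \<open>range i\<close> (they are killed by \<open>p\<close>),
  so \<open>inv i\<close> is the identification of \<open>range i\<close> with \<open>\<hh>\<close>.
\<close>

definition associated_cocycle ::
  "('g::ab_group_add \<Rightarrow> 'g \<Rightarrow> 'g) \<Rightarrow> ('g \<Rightarrow> 'g) \<Rightarrow> ('e::ab_group_add \<Rightarrow> 'e \<Rightarrow> 'e) \<Rightarrow> ('e \<Rightarrow> 'e)
    \<Rightarrow> ('h \<Rightarrow> 'e) \<Rightarrow> ('g \<Rightarrow> 'e) \<Rightarrow> ('g \<Rightarrow> 'g \<Rightarrow> 'h) \<times> ('g \<Rightarrow> 'h)"
  where "associated_cocycle brG T brE U i s =
    (\<lambda>x y. inv i (brE (s x) (s y) - s (brG x y)), \<lambda>x. inv i (U (s x) - s (T x)))"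

definition transported_cocycle ::
  "('h \<Rightarrow> 'h) \<Rightarrow> ('g \<Rightarrow> 'g) \<Rightarrow> ('g \<Rightarrow> 'g \<Rightarrow> 'h) \<times> ('g \<Rightarrow> 'h) \<Rightarrow> ('g \<Rightarrow> 'g \<Rightarrow> 'h) \<times> ('g \<Rightarrow> 'h)"
  where "transported_cocycle \<beta> \<alpha> = (\<lambda>(\<chi>, \<Phi>).
    (\<lambda>x y. \<beta> (\<chi> (inv \<alpha> x) (inv \<alpha> y)), \<lambda>x. \<beta> (\<Phi> (inv \<alpha> x))))"

section \<open>Compatible and inducible pairs\<close>

definition compatible_pairs ::
  "('k::field_char_0 \<Rightarrow> 'g::ab_group_add \<Rightarrow> 'g) \<Rightarrow> ('g \<Rightarrow> 'g \<Rightarrow> 'g) \<Rightarrow> ('g \<Rightarrow> 'g)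
    \<Rightarrow> ('k \<Rightarrow> 'h::ab_group_add \<Rightarrow> 'h) \<Rightarrow> ('g \<Rightarrow> 'h \<Rightarrow> 'h) \<Rightarrow> ('h \<Rightarrow> 'h)
    \<Rightarrow> (('h \<Rightarrow> 'h) \<times> ('g \<Rightarrow> 'g)) set"
  where "compatible_pairs scaleG brG T scaleH \<psi> S =
    {(\<beta>, \<alpha>) \<in> rota_baxter_aut scaleH zero_br S \<times> rota_baxter_aut scaleG brG T.
      \<forall>x h. \<beta> (\<psi> x h) = \<psi> (\<alpha> x) (\<beta> h)}"

text \<open>
  The condition \<open>p \<gamma> s = \<alpha>\<close> is imposed for every section \<open>s\<close>; by
  \<open>induced_map_section_independent\<close> below this is the same as imposing it for one section.
\<close>

definition inducible ::
  "('k::field_char_0 \<Rightarrow> 'g::ab_group_add \<Rightarrow> 'g) \<Rightarrow> ('k \<Rightarrow> 'e::ab_group_add \<Rightarrow> 'e)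
    \<Rightarrow> ('e \<Rightarrow> 'e \<Rightarrow> 'e) \<Rightarrow> ('e \<Rightarrow> 'e) \<Rightarrow> ('h \<Rightarrow> 'e) \<Rightarrow> ('e \<Rightarrow> 'g)
    \<Rightarrow> ('h \<Rightarrow> 'h) \<times> ('g \<Rightarrow> 'g) \<Rightarrow> bool"
  where "inducible scaleG scaleE brE U i p = (\<lambda>(\<beta>, \<alpha>).
    \<exists>\<gamma> \<in> rota_baxter_aut scaleE brE U.
      \<gamma> ` range i \<subseteq> range i \<and> (\<forall>h. \<gamma> (i h) = i (\<beta> h)) \<and>
      (\<forall>s. is_section scaleG scaleE p s \<longrightarrow> p \<circ> \<gamma> \<circ> s = \<alpha>))"

lemma (in abelian_extension) induced_map_section_independent:
  assumes \<gamma>: "\<gamma> \<in> rota_baxter_aut scaleE brE U" "\<gamma> ` range i \<subseteq> range i"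
    and s: "is_section scaleG scaleE p s" and s': "is_section scaleG scaleE p s'"
  shows "p \<circ> \<gamma> \<circ> s = p \<circ> \<gamma> \<circ> s'"
proof
  fix x
  interpret \<gamma>: rota_baxter_hom scaleE brE U scaleE brE U \<gamma>
    using \<gamma>(1) by (simp add: rota_baxter_aut_def)
  have "p (s x) = x" "p (s' x) = x"
    using s s' by (simp_all add: is_section_def fun_eq_iff)
  then have "s x - s' x \<in> range i"
    unfolding exact by (simp add: proj.diff)
  then have "\<gamma> (s x - s' x) \<in> range i"
    using \<gamma>(2) by blast
  then have "p (\<gamma> (s x) - \<gamma> (s' x)) = 0"
    unfolding exact by (simp add: \<gamma>.diff)
  then show "(p \<circ> \<gamma> \<circ> s) x = (p \<circ> \<gamma> \<circ> s') x"
    by (simp add: proj.diff)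
qed

end

theory Submission
  imports Defs
begin

text \<open>
  A section \<open>s\<close> identifies \<open>\<ee>\<close> with the vector space \<open>\<gg> \<oplus> \<hh>\<close> through \<open>(x, h) \<mapsto> s x + i h\<close>. In
  these coordinates the structure of \<open>\<ee>\<close> is that of \<open>\<gg>\<close> and of the representation \<open>\<hh>\<close>, twisted
  by the associated cocycle \<open>(\<chi>, \<Phi>)\<close>:
  \<open>[(x, h), (y, k)] = ([x, y], \<chi> x y + \<psi> x k - \<psi> y h)\<close> and \<open>U (x, h) = (T x, \<Phi> x + S h)\<close>
  (lemmas \<open>br_coordinates\<close> and \<open>U_coordinates\<close>). The Jacobi identity and the Rota-Baxter identity of
  \<open>\<ee>\<close>, read on \<open>\<hh>\<close>-coordinates, make \<open>(\<chi>, \<Phi>)\<close> a 2-cocycle (\<open>is_2_cocycle_associated\<close>).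

  A linear map of \<open>\<ee>\<close> that restricts to \<open>\<beta>\<close> on \<open>\<hh>\<close> and induces \<open>\<alpha>\<close> on \<open>\<gg>\<close> is block triangular:
  it is \<open>(x, h) \<mapsto> (\<alpha> x, \<beta> h + f (\<alpha> x))\<close> for a unique linear \<open>f : \<gg> \<rightarrow> \<hh>\<close>. Writing out when such
  a map respects the bracket and \<open>U\<close>, and comparing \<open>\<hh>\<close>-coordinates, the bracket of an element of
  \<open>\<gg>\<close> with one of \<open>\<hh>\<close> gives the compatibility of \<open>(\<beta>, \<alpha>)\<close> with \<open>\<psi>\<close>, the bracket of two elements
  of \<open>\<gg>\<close> gives \<open>\<beta> (\<chi> x y) - \<chi> (\<alpha> x) (\<alpha> y) = (\<delta>f) (\<alpha> x) (\<alpha> y)\<close>, and \<open>U\<close> on \<open>\<gg>\<close> gives the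
  analogous equation for \<open>\<Phi>\<close>; together these are sufficient (\<open>triangular_map_hom_iff\<close>). After the
  substitution of \<open>\<alpha>\<^sup>-\<^sup>1 x\<close> for \<open>x\<close> the last two say exactly that the transported
  cocycle minus \<open>(\<chi>, \<Phi>)\<close> is the coboundary of \<open>f\<close>. So inducing automorphisms \<open>\<gamma>\<close> correspond to such maps \<open>f\<close>.
\<close>

lemma (in lie_algebra) br_antisym: "br x y = - br y x"
proof -
  interpret left: Vector_Spaces.linear scale scale "\<lambda>x. br x y" for y
    by (rule br_linear_left)
  interpret right: Vector_Spaces.linear scale scale "br x" for x
    by (rule br_linear_right)
  have "br (x + y) (x + y) = 0"
    by (rule br_alternating)
  then have "br y x + br x y = 0"
    unfolding left.add right.add by (simp add: br_alternating)
  then show "br x y = - br y x"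
    by (rule minus_unique[symmetric])
qed


section \<open>Transporting cocycles along compatible pairs\<close>

lemma rota_baxter_aut_inv:
  assumes "\<alpha> \<in> rota_baxter_aut scale br T"
  shows "inv \<alpha> \<in> rota_baxter_aut scale br T"
proof -
  interpret \<alpha>: rota_baxter_hom scale br T scale br T \<alpha>
    using assms by (simp add: rota_baxter_aut_def)
  have bij: "bij \<alpha>"
    using assms by (simp add: rota_baxter_aut_def)
  then have inv_eq: "inv \<alpha> y = x" if "\<alpha> x = y" for x y
    using that by (auto simp: bij_is_inj)
  have [simp]: "\<alpha> (inv \<alpha> x) = x" for x
    using bij by (simp add: bij_is_surj surj_f_inv_f)
  have "rota_baxter_hom scale br T scale br T (inv \<alpha>)"
    by unfold_locales
      (auto intro!: inv_eq sym[OF inv_eq] simp: \<alpha>.add \<alpha>.scale \<alpha>.hom_br \<alpha>.hom_T[symmetric])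
  then show ?thesis
    using bij by (simp add: rota_baxter_aut_def bij_imp_bij_inv)
qed

text \<open>
  Applying \<open>\<beta>\<close> to the cocycle identities at \<open>\<alpha>\<^sup>-\<^sup>1 x, \<alpha>\<^sup>-\<^sup>1 y, \<dots>\<close> gives those of the transported
  pair: compatibility moves \<open>\<beta>\<close> past the action, and \<open>\<alpha>\<^sup>-\<^sup>1\<close> respects the bracket and \<open>T\<close>.
\<close>

lemma (in rota_baxter_representation) is_2_cocycle_transported:
  assumes compat: "(\<beta>, \<alpha>) \<in> compatible_pairs scaleG brG T scaleH \<psi> S"
    and cocycle: "is_2_cocycle scaleG brG T scaleH \<psi> S c"
  shows "is_2_cocycle scaleG brG T scaleH \<psi> S (transported_cocycle \<beta> \<alpha> c)"
proof -
  obtain \<chi> \<Phi> where c: "c = (\<chi>, \<Phi>)"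
    by (cases c)
  have \<beta>: "\<beta> \<in> rota_baxter_aut scaleH zero_br S" and \<alpha>: "\<alpha> \<in> rota_baxter_aut scaleG brG T"
    and \<beta>_\<psi>: "\<And>x h. \<beta> (\<psi> x h) = \<psi> (\<alpha> x) (\<beta> h)"
    using compat by (auto simp: compatible_pairs_def)
  interpret \<beta>: rota_baxter_hom scaleH zero_br S scaleH zero_br S \<beta>
    using \<beta> by (simp add: rota_baxter_aut_def)
  interpret \<alpha>': rota_baxter_hom scaleG brG T scaleG brG T "inv \<alpha>"
    using rota_baxter_aut_inv[OF \<alpha>] by (simp add: rota_baxter_aut_def)
  have "\<alpha> (inv \<alpha> x) = x" for x
    using \<alpha> by (simp add: rota_baxter_aut_def bij_is_surj surj_f_inv_f)
  then have \<psi>_\<beta>: "\<psi> x (\<beta> h) = \<beta> (\<psi> (inv \<alpha> x) h)" for x h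
    by (simp add: \<beta>_\<psi>)
  have linear_\<beta>_\<alpha>': "Vector_Spaces.linear scaleG scaleH (\<lambda>x. \<beta> (g (inv \<alpha> x)))"
    if "Vector_Spaces.linear scaleG scaleH g" for g
    using Vector_Spaces.linear_compose[OF Vector_Spaces.linear_compose[OF \<alpha>'.linear_axioms
        that] \<beta>.linear_axioms]
    by (simp add: o_def)
  have CE: "is_CE_2_cocycle scaleG brG scaleH \<psi> \<chi>"
    and \<Phi>: "Vector_Spaces.linear scaleG scaleH \<Phi>"
    and RB: "\<And>x y. \<psi> (T x) (\<Phi> y) - \<psi> (T y) (\<Phi> x) - S (\<psi> x (\<Phi> y) - \<psi> y (\<Phi> x))
      - \<Phi> (brG (T x) y + brG x (T y)) + \<chi> (T x) (T y) - S (\<chi> (T x) y + \<chi> x (T y)) = 0"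
    using cocycle unfolding is_2_cocycle_def c prod.case by blast+
  have linear_\<chi>: "Vector_Spaces.linear scaleG scaleH (\<lambda>x. \<chi> x y)"
      "Vector_Spaces.linear scaleG scaleH (\<lambda>y. \<chi> x y)"
    and alternating: "\<chi> x x = 0"
    and CE_identity: "\<psi> x (\<chi> y z) - \<psi> y (\<chi> x z) + \<psi> z (\<chi> x y)
      - \<chi> (brG x y) z + \<chi> (brG x z) y - \<chi> (brG y z) x = 0" for x y z
    using CE unfolding is_CE_2_cocycle_def by blast+
  have "\<beta> (\<psi> (inv \<alpha> x) (\<chi> (inv \<alpha> y) (inv \<alpha> z)) - \<psi> (inv \<alpha> y) (\<chi> (inv \<alpha> x) (inv \<alpha> z))
      + \<psi> (inv \<alpha> z) (\<chi> (inv \<alpha> x) (inv \<alpha> y)) - \<chi> (brG (inv \<alpha> x) (inv \<alpha> y)) (inv \<alpha> z)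
      + \<chi> (brG (inv \<alpha> x) (inv \<alpha> z)) (inv \<alpha> y) - \<chi> (brG (inv \<alpha> y) (inv \<alpha> z)) (inv \<alpha> x)) = 0"
    for x y z
    by (simp only: CE_identity \<beta>.zero)
  then have "is_CE_2_cocycle scaleG brG scaleH \<psi> (\<lambda>x y. \<beta> (\<chi> (inv \<alpha> x) (inv \<alpha> y)))"
    using linear_\<chi>[THEN linear_\<beta>_\<alpha>']
    by (simp add: is_CE_2_cocycle_def alternating \<beta>.zero \<beta>.add \<beta>.diff \<psi>_\<beta> \<alpha>'.hom_br)
  moreover have "\<beta> (\<psi> (T (inv \<alpha> x)) (\<Phi> (inv \<alpha> y)) - \<psi> (T (inv \<alpha> y)) (\<Phi> (inv \<alpha> x))
      - S (\<psi> (inv \<alpha> x) (\<Phi> (inv \<alpha> y)) - \<psi> (inv \<alpha> y) (\<Phi> (inv \<alpha> x)))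
      - \<Phi> (brG (T (inv \<alpha> x)) (inv \<alpha> y) + brG (inv \<alpha> x) (T (inv \<alpha> y)))
      + \<chi> (T (inv \<alpha> x)) (T (inv \<alpha> y))
      - S (\<chi> (T (inv \<alpha> x)) (inv \<alpha> y) + \<chi> (inv \<alpha> x) (T (inv \<alpha> y)))) = 0" for x y
    by (simp only: RB \<beta>.zero)
  ultimately show ?thesis
    using linear_\<beta>_\<alpha>'[OF \<Phi>]
    by (simp add: is_2_cocycle_def c transported_cocycle_def \<psi>_\<beta> \<beta>.add \<beta>.diff \<alpha>'.add
        \<alpha>'.hom_br \<beta>.hom_T[symmetric] \<alpha>'.hom_T[symmetric])
qed


section \<open>Coordinates on an abelian extension with a section\<close>

locale sectioned_abelian_extension =
  abelian_extension scaleG brG T scaleH \<psi> S scaleE brE U i p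
  for scaleG :: "'k::field_char_0 \<Rightarrow> 'g::ab_group_add \<Rightarrow> 'g"
    and brG :: "'g \<Rightarrow> 'g \<Rightarrow> 'g" and T :: "'g \<Rightarrow> 'g"
    and scaleH :: "'k \<Rightarrow> 'h::ab_group_add \<Rightarrow> 'h"
    and \<psi> :: "'g \<Rightarrow> 'h \<Rightarrow> 'h" and S :: "'h \<Rightarrow> 'h"
    and scaleE :: "'k \<Rightarrow> 'e::ab_group_add \<Rightarrow> 'e"
    and brE :: "'e \<Rightarrow> 'e \<Rightarrow> 'e" and U :: "'e \<Rightarrow> 'e"
    and i :: "'h \<Rightarrow> 'e" and p :: "'e \<Rightarrow> 'g" +
  fixes s :: "'g \<Rightarrow> 'e"
  assumes s_section: "is_section scaleG scaleE p s"
begin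

sublocale s: Vector_Spaces.linear scaleG scaleE s
  using s_section by (simp add: is_section_def)

lemma p_s [simp]: "p (s x) = x"
  using s_section by (simp add: is_section_def fun_eq_iff)

lemma p_i [simp]: "p (i h) = 0"
  using exact by blast

lemma i_eq_iff [simp]: "i h = i k \<longleftrightarrow> h = k"
  using inj_i by (simp add: inj_eq)

lemma i_inv_i: "p e = 0 \<Longrightarrow> i (inv i e) = e"
  using exact by (simp add: f_inv_into_f)

lemma coordinates_unique: "s x + i h = s y + i k \<longleftrightarrow> x = y \<and> h = k"
proof
  assume eq: "s x + i h = s y + i k"
  then have "p (s x + i h) = p (s y + i k)"
    by simp
  then have "x = y"
    by (simp add: proj.add)
  with eq show "x = y \<and> h = k"
    by simp
qed simp

definition coord :: "'e \<Rightarrow> 'h"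
  where "coord e = inv i (e - s (p e))"

lemma coordinates: "e = s (p e) + i (coord e)"
  by (simp add: coord_def i_inv_i proj.diff)

lemma coord_coordinates [simp]: "coord (s x + i h) = h"
  by (simp add: coord_def proj.add bij_is_inj inj_i)

lemma linear_coord: "Vector_Spaces.linear scaleE scaleH coord"
proof -
  have "coord (d + e) = coord d + coord e" for d e
  proof -
    have "i (coord (d + e)) = i (coord d + coord e)"
      by (simp add: coord_def i_inv_i incl.add proj.add proj.diff s.add)
    then show ?thesis by simp
  qed
  moreover have "coord (scaleE a e) = scaleH a (coord e)" for a e
  proof -
    have "i (coord (scaleE a e)) = i (scaleH a (coord e))"
      by (simp add: coord_def i_inv_i incl.scale proj.scale proj.diff s.scale
          incl.cod.scale_right_diff_distrib)
    then show ?thesis by simp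
  qed
  ultimately show ?thesis
    by unfold_locales
qed

definition \<chi> :: "'g \<Rightarrow> 'g \<Rightarrow> 'h"
  where "\<chi> x y = inv i (brE (s x) (s y) - s (brG x y))"

definition \<Phi> :: "'g \<Rightarrow> 'h"
  where "\<Phi> x = inv i (U (s x) - s (T x))"

lemma associated_cocycle_eq: "associated_cocycle brG T brE U i s = (\<chi>, \<Phi>)"
  by (simp add: associated_cocycle_def \<chi>_def \<Phi>_def fun_eq_iff)

sublocale S: Vector_Spaces.linear scaleH scaleH S
  by (rule S_linear)

sublocale U: Vector_Spaces.linear scaleE scaleE U
  by (rule incl.cod.T_linear)

sublocale \<psi>: Vector_Spaces.linear scaleH scaleH "\<psi> x" for x
  by (rule \<psi>_endo)

sublocale \<psi>_left: Vector_Spaces.linear scaleG scaleH "\<lambda>x. \<psi> x h" for h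
  by (rule \<psi>_linear)

sublocale brE_left: Vector_Spaces.linear scaleE scaleE "\<lambda>d. brE d e" for e
  by (rule incl.cod.br_linear_left)

sublocale brE_right: Vector_Spaces.linear scaleE scaleE "brE d" for d
  by (rule incl.cod.br_linear_right)

sublocale brG_right: Vector_Spaces.linear scaleG scaleG "brG x" for x
  by (rule br_linear_right)

sublocale coord: Vector_Spaces.linear scaleE scaleH coord
  by (rule linear_coord)

text \<open>
  The term in \<open>h\<close> and \<open>k\<close> alone vanishes because \<open>\<hh>\<close> is abelian; the terms in \<open>x, k\<close> and \<open>y, h\<close>
  are the action.
\<close>

lemma br_coordinates:
  "brE (s x + i h) (s y + i k) = s (brG x y) + i (\<chi> x y + \<psi> x k - \<psi> y h)"
proof -
  have "brE (s x) (s y) = s (brG x y) + i (\<chi> x y)"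
    by (simp add: \<chi>_def i_inv_i proj.diff proj.hom_br)
  moreover have "brE (s x) (i k) = i (\<psi> x k)"
    by (simp add: action[OF s_section])
  moreover have "brE (i h) (s y) = - i (\<psi> y h)"
    using incl.cod.br_antisym[of "i h" "s y"] by (simp add: action[OF s_section])
  moreover have "brE (i h) (i k) = 0"
    using incl.hom_br[of h k] by (simp add: incl.zero)
  ultimately show ?thesis
    by (simp add: brE_left.add brE_right.add incl.add incl.diff)
qed

lemma U_coordinates: "U (s x + i h) = s (T x) + i (\<Phi> x + S h)"
proof -
  have "U (s x) = s (T x) + i (\<Phi> x)"
    by (simp add: \<Phi>_def i_inv_i proj.diff flip: proj.hom_T)
  then show ?thesis
    by (simp add: U.add incl.hom_T incl.add)
qed

lemma br_s: "brE (s x) (s y) = s (brG x y) + i (\<chi> x y)"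
  using br_coordinates[of x 0 y 0] by (simp add: incl.zero \<psi>.zero)

lemma U_s: "U (s x) = s (T x) + i (\<Phi> x)"
  using U_coordinates[of x 0] by (simp add: incl.zero S.zero)

lemma linear_\<chi>_left: "Vector_Spaces.linear scaleG scaleH (\<lambda>x. \<chi> x y)"
  using Vector_Spaces.linear_compose[OF Vector_Spaces.linear_compose[OF s.linear_axioms
      brE_left.linear_axioms] linear_coord, of "s y"]
  by (simp add: o_def br_s)

lemma linear_\<chi>_right: "Vector_Spaces.linear scaleG scaleH (\<chi> x)"
  using Vector_Spaces.linear_compose[OF Vector_Spaces.linear_compose[OF s.linear_axioms
      brE_right.linear_axioms] linear_coord, of "s x"]
  by (simp add: o_def br_s)

lemma linear_\<Phi>: "Vector_Spaces.linear scaleG scaleH \<Phi>"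
  using Vector_Spaces.linear_compose[OF Vector_Spaces.linear_compose[OF s.linear_axioms
      U.linear_axioms] linear_coord]
  by (simp add: o_def U_s)

sublocale \<chi>_left: Vector_Spaces.linear scaleG scaleH "\<lambda>x. \<chi> x y" for y
  by (rule linear_\<chi>_left)

sublocale \<chi>_right: Vector_Spaces.linear scaleG scaleH "\<chi> x" for x
  by (rule linear_\<chi>_right)

lemma \<chi>_alternating: "\<chi> x x = 0"
  using br_s[of x x] coord_coordinates[of "brG x x" "\<chi> x x"]
  by (simp add: incl.cod.br_alternating coord.zero)

lemma \<chi>_antisym: "\<chi> x y = - \<chi> y x"
proof -
  have "\<chi> (x + y) (x + y) = 0"
    by (rule \<chi>_alternating)
  then have "\<chi> y x + \<chi> x y = 0"
    unfolding \<chi>_left.add \<chi>_right.add by (simp add: \<chi>_alternating)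
  then show ?thesis
    by (rule minus_unique[symmetric])
qed

text \<open>
  The \<open>\<hh>\<close>-coordinate of the Jacobi identity on \<open>s x, s y, s z\<close> is the Chevalley-Eilenberg identity,
  and that of the Rota-Baxter identity on \<open>s x, s y\<close> is the identity linking \<open>\<chi>\<close> and \<open>\<Phi>\<close>.
\<close>

lemma is_2_cocycle_associated: "is_2_cocycle scaleG brG T scaleH \<psi> S (\<chi>, \<Phi>)"
proof -
  have "\<psi> x (\<chi> y z) - \<psi> y (\<chi> x z) + \<psi> z (\<chi> x y)
      - \<chi> (brG x y) z + \<chi> (brG x z) y - \<chi> (brG y z) x = 0" for x y z
  proof -
    have "coord (brE (s x) (brE (s y) (s z))) = \<chi> x (brG y z) + \<psi> x (\<chi> y z)" for x y z
      using br_coordinates[of x 0 "brG y z" "\<chi> y z"]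
      by (simp add: incl.zero \<psi>.zero br_s)
    then have "\<chi> x (brG y z) + \<psi> x (\<chi> y z) + (\<chi> y (brG z x) + \<psi> y (\<chi> z x))
        + (\<chi> z (brG x y) + \<psi> z (\<chi> x y)) = 0"
      using arg_cong[OF incl.cod.jacobi[of "s x" "s y" "s z"], of coord]
      by (simp add: coord.add coord.zero)
    moreover have "\<chi> (brG x y) z = - \<chi> z (brG x y)" "\<chi> (brG y z) x = - \<chi> x (brG y z)"
      "\<chi> (brG x z) y = \<chi> y (brG z x)" "\<psi> y (\<chi> x z) = - \<psi> y (\<chi> z x)"
      using \<chi>_antisym[of "brG x y" z] \<chi>_antisym[of "brG y z" x] \<chi>_antisym[of "brG x z" y]
        \<chi>_antisym[of x z] br_antisym[of x z]
      by (simp_all add: \<chi>_right.neg \<psi>.neg)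
    ultimately show ?thesis
      by (simp add: algebra_simps)
  qed
  moreover have "\<psi> (T x) (\<Phi> y) - \<psi> (T y) (\<Phi> x) - S (\<psi> x (\<Phi> y) - \<psi> y (\<Phi> x))
      - \<Phi> (brG (T x) y + brG x (T y))
      + \<chi> (T x) (T y) - S (\<chi> (T x) y + \<chi> x (T y)) = 0" for x y
  proof -
    have "brE (U (s x)) (U (s y))
        = s (brG (T x) (T y)) + i (\<chi> (T x) (T y) + \<psi> (T x) (\<Phi> y) - \<psi> (T y) (\<Phi> x))"
      by (simp only: U_s br_coordinates)
    moreover have "brE (U (s x)) (s y) + brE (s x) (U (s y))
        = s (brG (T x) y + brG x (T y))
          + i (\<chi> (T x) y - \<psi> y (\<Phi> x) + (\<chi> x (T y) + \<psi> x (\<Phi> y)))"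
      using br_coordinates[of "T x" "\<Phi> x" y 0] br_coordinates[of x 0 "T y" "\<Phi> y"]
      by (simp add: U_s incl.zero \<psi>.zero incl.add s.add)
    ultimately have "\<chi> (T x) (T y) + \<psi> (T x) (\<Phi> y) - \<psi> (T y) (\<Phi> x)
        = \<Phi> (brG (T x) y + brG x (T y))
          + S (\<chi> (T x) y - \<psi> y (\<Phi> x) + (\<chi> x (T y) + \<psi> x (\<Phi> y)))"
      using incl.cod.rota_baxter[of "s x" "s y"]
      by (simp only: U_coordinates coordinates_unique)
    then show ?thesis
      by (simp add: S.add S.diff algebra_simps)
  qed
  ultimately show ?thesis
    by (simp add: is_2_cocycle_def is_CE_2_cocycle_def linear_\<chi>_left linear_\<chi>_right linear_\<Phi>
        \<chi>_alternating)
qed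


section \<open>Block triangular automorphisms\<close>

text \<open>
  The block triangular map with diagonal \<open>(\<alpha>, \<beta>)\<close>. The off-diagonal entry is written \<open>f \<circ> \<alpha>\<close>
  rather than \<open>f\<close> so that the coboundary of \<open>f\<close> itself becomes the difference of the transported
  and the original cocycle.
\<close>

definition triangular_map :: "('h \<Rightarrow> 'h) \<Rightarrow> ('g \<Rightarrow> 'g) \<Rightarrow> ('g \<Rightarrow> 'h) \<Rightarrow> 'e \<Rightarrow> 'e"
  where "triangular_map \<beta> \<alpha> f e = s (\<alpha> (p e)) + i (\<beta> (coord e) + f (\<alpha> (p e)))"

lemma triangular_map_coordinates:
  "triangular_map \<beta> \<alpha> f (s x + i h) = s (\<alpha> x) + i (\<beta> h + f (\<alpha> x))"
  by (simp add: triangular_map_def proj.add)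

lemma linear_triangular_map:
  assumes "Vector_Spaces.linear scaleH scaleH \<beta>" "Vector_Spaces.linear scaleG scaleG \<alpha>"
    "Vector_Spaces.linear scaleG scaleH f"
  shows "Vector_Spaces.linear scaleE scaleE (triangular_map \<beta> \<alpha> f)"
proof -
  interpret \<beta>: Vector_Spaces.linear scaleH scaleH \<beta> by fact
  interpret \<alpha>: Vector_Spaces.linear scaleG scaleG \<alpha> by fact
  interpret f: Vector_Spaces.linear scaleG scaleH f by fact
  show ?thesis
    by unfold_locales
      (simp_all add: triangular_map_def coord.add proj.add \<alpha>.add s.add \<beta>.add f.add incl.add
        coord.scale proj.scale \<alpha>.scale s.scale \<beta>.scale f.scale incl.scale
        incl.cod.scale_right_distrib)
qed

lemma bij_triangular_map:
  assumes "bij \<beta>" "bij \<alpha>"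
  shows "bij (triangular_map \<beta> \<alpha> f)"
proof (rule bijI)
  show "inj (triangular_map \<beta> \<alpha> f)"
  proof
    fix d e
    assume "triangular_map \<beta> \<alpha> f d = triangular_map \<beta> \<alpha> f e"
    then have "p d = p e \<and> coord d = coord e"
      using assms by (auto simp: triangular_map_def coordinates_unique bij_is_inj inj_eq)
    then show "d = e"
      using coordinates[of d] coordinates[of e] by simp
  qed
  have "triangular_map \<beta> \<alpha> f (s (inv \<alpha> (p e)) + i (inv \<beta> (coord e - f (p e)))) = e" for e
    using assms coordinates[of e]
    by (simp add: triangular_map_coordinates bij_is_surj surj_f_inv_f)
  then show "surj (triangular_map \<beta> \<alpha> f)"
    unfolding surj_def by metis
qed

text \<open>
  The two sides of each homomorphism equation have the same \<open>\<gg>\<close>-coordinate since \<open>\<alpha>\<close> is a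
  morphism, so only the \<open>\<hh>\<close>-coordinates matter. Conversely, the equation for the bracket splits into
  the two conditions on \<open>\<psi>\<close> and \<open>\<chi>\<close> by putting \<open>y = 0, h = 0\<close> and \<open>h = k = 0\<close>.
\<close>

lemma triangular_map_hom_iff:
  assumes \<beta>: "\<beta> \<in> rota_baxter_aut scaleH zero_br S"
    and \<alpha>: "\<alpha> \<in> rota_baxter_aut scaleG brG T"
    and f: "Vector_Spaces.linear scaleG scaleH f"
  shows "rota_baxter_hom scaleE brE U scaleE brE U (triangular_map \<beta> \<alpha> f) \<longleftrightarrow>
    (\<forall>x h. \<beta> (\<psi> x h) = \<psi> (\<alpha> x) (\<beta> h)) \<and>
    (\<forall>x y. \<beta> (\<chi> x y) - \<chi> (\<alpha> x) (\<alpha> y)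
      = \<psi> (\<alpha> x) (f (\<alpha> y)) - \<psi> (\<alpha> y) (f (\<alpha> x)) - f (brG (\<alpha> x) (\<alpha> y))) \<and>
    (\<forall>x. \<beta> (\<Phi> x) - \<Phi> (\<alpha> x) = S (f (\<alpha> x)) - f (T (\<alpha> x)))"
    (is "?hom \<longleftrightarrow> ?\<psi> \<and> ?\<chi> \<and> ?\<Phi>")
proof -
  interpret \<beta>: rota_baxter_hom scaleH zero_br S scaleH zero_br S \<beta>
    using \<beta> by (simp add: rota_baxter_aut_def)
  interpret \<alpha>: rota_baxter_hom scaleG brG T scaleG brG T \<alpha>
    using \<alpha> by (simp add: rota_baxter_aut_def)
  interpret f: Vector_Spaces.linear scaleG scaleH f
    by fact
  let ?\<gamma> = "triangular_map \<beta> \<alpha> f"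
  have br_iff: "?\<gamma> (brE (s x + i h) (s y + i k)) = brE (?\<gamma> (s x + i h)) (?\<gamma> (s y + i k)) \<longleftrightarrow>
      \<beta> (\<chi> x y + \<psi> x k - \<psi> y h) + f (brG (\<alpha> x) (\<alpha> y))
      = \<chi> (\<alpha> x) (\<alpha> y) + \<psi> (\<alpha> x) (\<beta> k + f (\<alpha> y)) - \<psi> (\<alpha> y) (\<beta> h + f (\<alpha> x))" for x y h k
    by (simp add: br_coordinates triangular_map_coordinates coordinates_unique \<alpha>.hom_br)
  have U_iff: "U (?\<gamma> (s x + i h)) = ?\<gamma> (U (s x + i h)) \<longleftrightarrow>
      \<Phi> (\<alpha> x) + S (\<beta> h + f (\<alpha> x)) = \<beta> (\<Phi> x + S h) + f (T (\<alpha> x))" for x h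
    by (simp add: U_coordinates triangular_map_coordinates coordinates_unique \<alpha>.hom_T)
  show ?thesis
  proof (intro iffI conjI allI)
    assume ?hom
    then interpret \<gamma>: rota_baxter_hom scaleE brE U scaleE brE U ?\<gamma> .
    have br: "\<beta> (\<chi> x y + \<psi> x k - \<psi> y h) + f (brG (\<alpha> x) (\<alpha> y))
      = \<chi> (\<alpha> x) (\<alpha> y) + \<psi> (\<alpha> x) (\<beta> k + f (\<alpha> y)) - \<psi> (\<alpha> y) (\<beta> h + f (\<alpha> x))" for x y h k
      using br_iff \<gamma>.hom_br by blast
    show "\<beta> (\<psi> x k) = \<psi> (\<alpha> x) (\<beta> k)" for x k
      using br[of x 0 k 0]
      by (simp add: \<chi>_right.zero \<psi>_left.zero \<alpha>.zero f.zero brG_right.zero)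
    show "\<beta> (\<chi> x y) - \<chi> (\<alpha> x) (\<alpha> y)
      = \<psi> (\<alpha> x) (f (\<alpha> y)) - \<psi> (\<alpha> y) (f (\<alpha> x)) - f (brG (\<alpha> x) (\<alpha> y))" for x y
      using br[of x y 0 0] by (simp add: \<psi>.zero \<beta>.zero algebra_simps)
    show "\<beta> (\<Phi> x) - \<Phi> (\<alpha> x) = S (f (\<alpha> x)) - f (T (\<alpha> x))" for x
      using U_iff[of x 0] \<gamma>.hom_T by (simp add: S.zero \<beta>.zero algebra_simps)
  next
    assume conds: "?\<psi> \<and> ?\<chi> \<and> ?\<Phi>"
    interpret \<gamma>: Vector_Spaces.linear scaleE scaleE ?\<gamma>
      using linear_triangular_map[OF \<beta>.linear_axioms \<alpha>.linear_axioms f] .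
    show ?hom
    proof
      fix d e
      have "\<beta> (\<chi> x y + \<psi> x k - \<psi> y h) + f (brG (\<alpha> x) (\<alpha> y))
        = \<chi> (\<alpha> x) (\<alpha> y) + \<psi> (\<alpha> x) (\<beta> k + f (\<alpha> y)) - \<psi> (\<alpha> y) (\<beta> h + f (\<alpha> x))" for x y h k
        using conds by (simp add: \<beta>.add \<beta>.diff \<psi>.add algebra_simps)
      then show "?\<gamma> (brE d e) = brE (?\<gamma> d) (?\<gamma> e)"
        using br_iff coordinates[of d] coordinates[of e] by metis
      have "\<Phi> (\<alpha> x) + S (\<beta> h + f (\<alpha> x)) = \<beta> (\<Phi> x + S h) + f (T (\<alpha> x))" for x h
        using conds by (simp add: \<beta>.add S.add \<beta>.hom_T algebra_simps)
      then show "U (?\<gamma> e) = ?\<gamma> (U e)"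
        using U_iff coordinates[of e] by metis
    qed
  qed
qed

text \<open>
  An inducing automorphism \<open>\<gamma>\<close> maps \<open>s x\<close> to \<open>s (\<alpha> x)\<close> up to \<open>\<hh>\<close>, so it is block triangular with
  off-diagonal entry the \<open>\<hh>\<close>-coordinate of \<open>\<gamma> (s x)\<close>.
\<close>

lemma inducible_iff_triangular:
  assumes \<beta>: "\<beta> \<in> rota_baxter_aut scaleH zero_br S"
    and \<alpha>: "\<alpha> \<in> rota_baxter_aut scaleG brG T"
  shows "inducible scaleG scaleE brE U i p (\<beta>, \<alpha>) \<longleftrightarrow>
    (\<exists>f. Vector_Spaces.linear scaleG scaleH f \<and>
      rota_baxter_hom scaleE brE U scaleE brE U (triangular_map \<beta> \<alpha> f))"
proof
  assume "inducible scaleG scaleE brE U i p (\<beta>, \<alpha>)"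
  then obtain \<gamma> where hom: "rota_baxter_hom scaleE brE U scaleE brE U \<gamma>"
    and \<gamma>_i: "\<And>h. \<gamma> (i h) = i (\<beta> h)" and p_\<gamma>_s: "p \<circ> \<gamma> \<circ> s = \<alpha>"
    using s_section by (auto simp: inducible_def rota_baxter_aut_def)
  interpret \<gamma>: rota_baxter_hom scaleE brE U scaleE brE U \<gamma>
    by (rule hom)
  define f where "f = coord \<circ> \<gamma> \<circ> s \<circ> inv \<alpha>"
  have "Vector_Spaces.linear scaleG scaleG (inv \<alpha>)"
    using rota_baxter_aut_inv[OF \<alpha>] by (simp add: rota_baxter_aut_def rota_baxter_hom_def)
  then have "Vector_Spaces.linear scaleG scaleH f"
    unfolding f_def
    by (rule Vector_Spaces.linear_compose[OF _ Vector_Spaces.linear_compose[OF s.linear_axioms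
      Vector_Spaces.linear_compose[OF \<gamma>.linear_axioms linear_coord]], unfolded o_assoc])
  moreover have "\<gamma> = triangular_map \<beta> \<alpha> f"
  proof
    fix e
    have "f (\<alpha> x) = coord (\<gamma> (s x))" for x
      using \<alpha> by (simp add: f_def rota_baxter_aut_def bij_is_inj)
    then have "\<gamma> (s x) = s (\<alpha> x) + i (f (\<alpha> x))" for x
      using coordinates[of "\<gamma> (s x)"] p_\<gamma>_s by auto
    then have "\<gamma> (s x + i h) = triangular_map \<beta> \<alpha> f (s x + i h)" for x h
      by (simp add: triangular_map_coordinates \<gamma>.add \<gamma>_i incl.add)
    then show "\<gamma> e = triangular_map \<beta> \<alpha> f e"
      by (metis coordinates)
  qed
  ultimately show "\<exists>f. Vector_Spaces.linear scaleG scaleH f \<and>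
      rota_baxter_hom scaleE brE U scaleE brE U (triangular_map \<beta> \<alpha> f)"
    using hom by blast
next
  assume "\<exists>f. Vector_Spaces.linear scaleG scaleH f \<and>
      rota_baxter_hom scaleE brE U scaleE brE U (triangular_map \<beta> \<alpha> f)"
  then obtain f where f: "Vector_Spaces.linear scaleG scaleH f"
    and hom: "rota_baxter_hom scaleE brE U scaleE brE U (triangular_map \<beta> \<alpha> f)"
    by blast
  interpret \<alpha>: rota_baxter_hom scaleG brG T scaleG brG T \<alpha>
    using \<alpha> by (simp add: rota_baxter_aut_def)
  interpret f: Vector_Spaces.linear scaleG scaleH f
    by (rule f)
  have "triangular_map \<beta> \<alpha> f \<in> rota_baxter_aut scaleE brE U"
    using hom \<alpha> \<beta> by (simp add: rota_baxter_aut_def bij_triangular_map)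
  moreover have "triangular_map \<beta> \<alpha> f (i h) = i (\<beta> h)" for h
    using triangular_map_coordinates[of \<beta> \<alpha> f 0 h] by (simp add: s.zero \<alpha>.zero f.zero)
  moreover have "p \<circ> triangular_map \<beta> \<alpha> f \<circ> s' = \<alpha>" if "is_section scaleG scaleE p s'" for s'
    using that by (simp add: is_section_def fun_eq_iff triangular_map_def proj.add)
  ultimately show "inducible scaleG scaleE brE U i p (\<beta>, \<alpha>)"
    unfolding inducible_def by (auto intro!: bexI[of _ "triangular_map \<beta> \<alpha> f"])
qed

text \<open>
  Substituting \<open>\<alpha> x\<close> for \<open>x\<close> removes \<open>\<alpha>\<^sup>-\<^sup>1\<close> from the coboundary equations and turns them into the
  conditions for a block triangular map to be a morphism. That the transported pair is a cocycle at
  all, as \<open>cohomologous\<close> demands, comes from compatibility.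
\<close>

lemma inducible_iff:
  assumes \<beta>: "\<beta> \<in> rota_baxter_aut scaleH zero_br S"
    and \<alpha>: "\<alpha> \<in> rota_baxter_aut scaleG brG T"
  shows "inducible scaleG scaleE brE U i p (\<beta>, \<alpha>) \<longleftrightarrow>
    (\<beta>, \<alpha>) \<in> compatible_pairs scaleG brG T scaleH \<psi> S \<and>
    cohomologous scaleG brG T scaleH \<psi> S (transported_cocycle \<beta> \<alpha> (\<chi>, \<Phi>)) (\<chi>, \<Phi>)"
proof -
  have "bij \<alpha>"
    using \<alpha> by (simp add: rota_baxter_aut_def)
  then have [simp]: "inv \<alpha> (\<alpha> x) = x" "\<alpha> (inv \<alpha> x) = x" for x
    by (simp_all add: bij_is_inj bij_is_surj surj_f_inv_f)
  have all_\<alpha>: "(\<forall>x. P x) \<longleftrightarrow> (\<forall>x. P (\<alpha> x))" for P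
    by (metis \<open>\<And>x. \<alpha> (inv \<alpha> x) = x\<close>)
  have coboundary_\<chi>: "(\<forall>x y. \<beta> (\<chi> (inv \<alpha> x) (inv \<alpha> y)) - \<chi> x y
        = \<psi> x (f y) - \<psi> y (f x) - f (brG x y)) \<longleftrightarrow>
      (\<forall>x y. \<beta> (\<chi> x y) - \<chi> (\<alpha> x) (\<alpha> y)
        = \<psi> (\<alpha> x) (f (\<alpha> y)) - \<psi> (\<alpha> y) (f (\<alpha> x)) - f (brG (\<alpha> x) (\<alpha> y)))" for f
    by (subst all_\<alpha>, subst (2) all_\<alpha>) simp
  have coboundary_\<Phi>: "(\<forall>x. \<beta> (\<Phi> (inv \<alpha> x)) - \<Phi> x = S (f x) - f (T x)) \<longleftrightarrow>
      (\<forall>x. \<beta> (\<Phi> x) - \<Phi> (\<alpha> x) = S (f (\<alpha> x)) - f (T (\<alpha> x)))" for f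
    by (subst all_\<alpha>) simp
  have compat: "(\<beta>, \<alpha>) \<in> compatible_pairs scaleG brG T scaleH \<psi> S \<longleftrightarrow>
      (\<forall>x h. \<beta> (\<psi> x h) = \<psi> (\<alpha> x) (\<beta> h))"
    using \<alpha> \<beta> by (simp add: compatible_pairs_def)
  have "cohomologous scaleG brG T scaleH \<psi> S (transported_cocycle \<beta> \<alpha> (\<chi>, \<Phi>)) (\<chi>, \<Phi>) \<longleftrightarrow>
      (\<exists>f. Vector_Spaces.linear scaleG scaleH f \<and>
        (\<forall>x y. \<beta> (\<chi> x y) - \<chi> (\<alpha> x) (\<alpha> y)
          = \<psi> (\<alpha> x) (f (\<alpha> y)) - \<psi> (\<alpha> y) (f (\<alpha> x)) - f (brG (\<alpha> x) (\<alpha> y))) \<and>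
        (\<forall>x. \<beta> (\<Phi> x) - \<Phi> (\<alpha> x) = S (f (\<alpha> x)) - f (T (\<alpha> x))))"
    if "(\<beta>, \<alpha>) \<in> compatible_pairs scaleG brG T scaleH \<psi> S"
    using is_2_cocycle_transported[OF that is_2_cocycle_associated] is_2_cocycle_associated
    by (simp add: cohomologous_def transported_cocycle_def coboundary_\<chi> coboundary_\<Phi>)
  then show ?thesis
    using inducible_iff_triangular[OF \<beta> \<alpha>] triangular_map_hom_iff[OF \<beta> \<alpha>] compat by blast
qed

end

theorem theorem6p4:
  fixes scaleG :: "'k::field_char_0 \<Rightarrow> 'g::ab_group_add \<Rightarrow> 'g"
    and brG :: "'g \<Rightarrow> 'g \<Rightarrow> 'g" and T :: "'g \<Rightarrow> 'g"
    and scaleH :: "'k \<Rightarrow> 'h::ab_group_add \<Rightarrow> 'h"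
    and \<psi> :: "'g \<Rightarrow> 'h \<Rightarrow> 'h" and S :: "'h \<Rightarrow> 'h"
    and scaleE :: "'k \<Rightarrow> 'e::ab_group_add \<Rightarrow> 'e"
    and brE :: "'e \<Rightarrow> 'e \<Rightarrow> 'e" and U :: "'e \<Rightarrow> 'e"
    and i :: "'h \<Rightarrow> 'e" and p :: "'e \<Rightarrow> 'g" and s :: "'g \<Rightarrow> 'e"
    and \<beta> :: "'h \<Rightarrow> 'h" and \<alpha> :: "'g \<Rightarrow> 'g"
    and \<chi> :: "'g \<Rightarrow> 'g \<Rightarrow> 'h" and \<Phi> :: "'g \<Rightarrow> 'h"
  assumes "abelian_extension scaleG brG T scaleH \<psi> S scaleE brE U i p"
    and "is_section scaleG scaleE p s"
    and "(\<chi>, \<Phi>) = associated_cocycle brG T brE U i s"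
    and "\<beta> \<in> rota_baxter_aut scaleH zero_br S"
    and "\<alpha> \<in> rota_baxter_aut scaleG brG T"
  shows "inducible scaleG scaleE brE U i p (\<beta>, \<alpha>) \<longleftrightarrow>
    (\<beta>, \<alpha>) \<in> compatible_pairs scaleG brG T scaleH \<psi> S \<and>
    cohomologous scaleG brG T scaleH \<psi> S
      (transported_cocycle \<beta> \<alpha> (\<chi>, \<Phi>)) (\<chi>, \<Phi>)"
proof -
  interpret sectioned_abelian_extension scaleG brG T scaleH \<psi> S scaleE brE U i p s
    using assms(1,2)
    by (simp add: sectioned_abelian_extension_def sectioned_abelian_extension_axioms_def)
  show ?thesis
    using inducible_iff[OF assms(4,5)] assms(3) by (simp add: associated_cocycle_eq)
qed

end
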